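(* Let $m,n$ be positive integers with $m>1$ and $m\mid n$. Let $\pi$ be an $(n,m)$-p.a.p. with parameters $(\vec a,\vec b,\vec c)$, with principal product $P_\pi>1$ and principal sum $S_\pi$. Let $g_\pi=\gcd\left(\frac{S_\pi}{m},P_\pi-1\right)$ and write $\frac nm=N_1N_2$, where $\mathrm{rad}(N_1)$ divides $\frac{P_\pi-1}{g_\pi}$ and $\gcd\left(\frac{P_\pi-1}{g_\pi},N_2\right)=1$. For each divisor $d$ of $N_2$, set $\eta(d)=N_1\cdot\frac{P_\pi-1}{g_\pi}\cdot d$. Then the cycle decomposition of $\pi$ is given by $$\bigoplus_{d\mid N_2}\frac{\varphi(d)\cdot N_1}{\mathrm{ord}_{\eta(d)}P_\pi}\times \mathrm{Cyc}\left(m\cdot \mathrm{ord}_{\eta(d)}P_\pi\right).$$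
   Context: For a positive integer $k$, $[1,k]=\{1,\dots,k\}$. For an integer $k>1$ and a positive integer $a$, $\Psi_k(a)$ is the unique element of $[1,k]$ congruent to $a$ modulo $k$. $\mathcal C(m)$ is the set of vectors $\vec c\in[1,m]^m$ whose entries comprise a permutation of $[1,m]$. The $i$-th coordinate of $\vec a$ is denoted $a_i$ (similarly for other vectors), and indices of coordinates are taken modulo $m$. An $(n,m)$-piecewise affine permutation ($(n,m)$-p.a.p.) is a permutation $\pi$ of $[1,n]$ such that there exist $\vec a,\vec b\in[1,n]^m$ and $\vec c\in\mathcal C(m)$ with the property that $\pi(x)=\Psi_n(a_ix+b_i)$ and $\Psi_m(\pi(x))=c_{i+1}$ for any $x\in[1,n]$ with $\Psi_m(x)=c_i$. Then $\pi$ is called the $(n,m)$-p.a.p. with parameters $(\vec a,\vec b,\vec c)$. The principal product of $\pi=\pi(\vec a,\vec b,\vec c)$ is $P_\pi=\prod_{i=1}^m a_i$ (as an integer). The principal sum of $\pi$ is the unique integer $S_\pi\in[1,n]$ such that $\pi^{(m)}(x)=\Psi_n(P_\pi\cdot x+S_\pi)$ for every $x\in[1,n]$ with $x\equiv0\pmod m$, where $\pi^{(m)}$ is the $m$-th iterate; one has $m\mid S_\pi$. $\mathrm{rad}(N)$ is the product of the distinct prime divisors of $N$ ($\mathrm{rad}(1)=1$), $\varphi$ is Euler's totient function, and $\mathrm{ord}_k r$ is the multiplicative order of $r$ modulo $k$ (equal to $1$ if $k=1$). $\mathrm{Cyc}(r)$ denotes a cycle of length $r$, $\bigoplus$ denotes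 disjoint union of graphs, and $k\times G$ is the disjoint union of $k$ copies of $G$; the cycle decomposition of a permutation is the disjoint union of its cycles. *)

theory Defs
  imports
    "HOL-Number_Theory.Number_Theory"
    "HOL-Combinatorics.Permutations"
    "HOL-Combinatorics.Orbits"
    "Graph_Theory.Pair_Digraph"
    "Graph_Theory.Digraph_Isomorphism"
begin

section \<open>Piecewise affine permutations\<close>

definition Psi :: "nat \<Rightarrow> nat \<Rightarrow> nat" where
  "Psi k a = (THE r. r \<in> {1..k} \<and> [r = a] (mod k))"

lemma Psi_eq:
  assumes "k > 0"
  shows "Psi k a = (if k dvd a then k else a mod k)"
  unfolding Psi_def
proof (rule the_equality)
  show "(if k dvd a then k else a mod k) \<in> {1..k} \<and>
        [(if k dvd a then k else a mod k) = a] (mod k)"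
    using assms
    by (auto simp: cong_def mod_greater_zero_iff_not_dvd Suc_le_eq intro: less_imp_le)
next
  fix r assume r: "r \<in> {1..k} \<and> [r = a] (mod k)"
  show "r = (if k dvd a then k else a mod k)"
  proof (cases "r = k")
    case True
    then show ?thesis using r by (auto simp: cong_def)
  next
    case False
    then have "r mod k = r" using r by simp
    then show ?thesis using r by (auto simp: cong_def dvd_eq_mod_eq_0)
  qed
qed

text \<open>
  An \<open>m\<close>-vector is a function on \<open>nat\<close> of which only the values at the indices \<open>{1..m}\<close>
  matter. The index \<open>i + 1\<close>, read modulo \<open>m\<close>, is \<open>Psi m (i + 1)\<close>.
\<close>

definition perm_vectors :: "nat \<Rightarrow> (nat \<Rightarrow> nat) set" where
  "perm_vectors m = {c. bij_betw c {1..m} {1..m}}"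

definition is_pap ::
  "nat \<Rightarrow> nat \<Rightarrow> (nat \<Rightarrow> nat) \<Rightarrow> (nat \<Rightarrow> nat) \<Rightarrow> (nat \<Rightarrow> nat) \<Rightarrow> (nat \<Rightarrow> nat) \<Rightarrow> bool"
where
  "is_pap n m \<pi> a b c \<longleftrightarrow>
     \<pi> permutes {1..n} \<and>
     a \<in> {1..m} \<rightarrow> {1..n} \<and>
     b \<in> {1..m} \<rightarrow> {1..n} \<and>
     c \<in> perm_vectors m \<and>
     (\<forall>x\<in>{1..n}. \<forall>i\<in>{1..m}. Psi m x = c i \<longrightarrow>
        \<pi> x = Psi n (a i * x + b i) \<and> Psi m (\<pi> x) = c (Psi m (i + 1)))"

definition principal_product :: "nat \<Rightarrow> (nat \<Rightarrow> nat) \<Rightarrow> nat" where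
  "principal_product m a = (\<Prod>i=1..m. a i)"

definition principal_sum :: "nat \<Rightarrow> nat \<Rightarrow> (nat \<Rightarrow> nat) \<Rightarrow> (nat \<Rightarrow> nat) \<Rightarrow> nat" where
  "principal_sum n m \<pi> a =
     (THE S. S \<in> {1..n} \<and>
        (\<forall>x\<in>{1..n}. [x = 0] (mod m) \<longrightarrow> (\<pi> ^^ m) x = Psi n (principal_product m a * x + S)))"

definition rad :: "nat \<Rightarrow> nat" where
  "rad N = \<Prod>(prime_factors N)"


section \<open>Cycles and disjoint unions of directed graphs\<close>

definition Cyc :: "nat \<Rightarrow> nat pair_pre_digraph" where
  "Cyc r = \<lparr> pverts = {..<r}, parcs = {(i, (i + 1) mod r) | i. i < r} \<rparr>"

definition disjoint_union ::
  "'i set \<Rightarrow> ('i \<Rightarrow> 'a pair_pre_digraph) \<Rightarrow> ('i \<times> 'a) pair_pre_digraph"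
where
  "disjoint_union I G =
     \<lparr> pverts = {(i, u) | i u. i \<in> I \<and> u \<in> pverts (G i)},
       parcs = {((i, u), (i, v)) | i u v. i \<in> I \<and> (u, v) \<in> parcs (G i)} \<rparr>"

definition copies :: "nat \<Rightarrow> 'a pair_pre_digraph \<Rightarrow> (nat \<times> 'a) pair_pre_digraph" where
  "copies k G = disjoint_union {..<k} (\<lambda>_. G)"

text \<open>
  The cycles of a permutation of the finite set \<open>A\<close> are its orbits, each with the arcs
  \<open>x \<rightarrow> \<pi> x\<close>; a fixed point is a loop. Distinct cycles correspond to distinct orbits.
\<close>

definition cycle_on :: "('a \<Rightarrow> 'a) \<Rightarrow> 'a set \<Rightarrow> 'a pair_pre_digraph" where
  "cycle_on \<pi> X = \<lparr> pverts = X, parcs = {(x, \<pi> x) | x. x \<in> X} \<rparr>"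

definition cycle_decomposition ::
  "('a \<Rightarrow> 'a) \<Rightarrow> 'a set \<Rightarrow> ('a set \<times> 'a) pair_pre_digraph"
where
  "cycle_decomposition \<pi> A = disjoint_union (orbit \<pi> ` A) (cycle_on \<pi>)"

end

theory Submission
  imports Defs
begin

text \<open>
  Since \<open>\<pi>\<close> moves the residue classes modulo \<open>m\<close> cyclically, every cycle meets the multiples
  of \<open>m\<close>, and its length is \<open>m\<close> times the length of a cycle of \<open>\<pi> ^^ m\<close> on them. With \<open>x = m * t\<close>
  and \<open>s = S div m\<close>, the latter permutation is the affine map \<open>t \<mapsto> P * t + s\<close> on the residues modulo
  \<open>N1 * N2\<close>. Put \<open>q = (P - 1) div g\<close> and \<open>u = q * t + s div g\<close>. Then \<open>t\<close> is fixed by the \<open>k\<close>-th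
  iterate iff \<open>q * N1 * N2\<close> divides \<open>(P ^ k - 1) * u\<close>. As \<open>u\<close> is coprime to \<open>q\<close>, hence to \<open>N1\<close>, this
  means that the order of \<open>P\<close> modulo \<open>N1 * q * d\<close> divides \<open>k\<close>, where \<open>d = N2 div gcd N2 u\<close>. The map
  multiplies \<open>u\<close> by \<open>P\<close>, so \<open>d\<close> is constant on cycles; and since \<open>q\<close> is invertible modulo \<open>N2\<close>,
  each \<open>d\<close> dividing \<open>N2\<close> occurs for exactly \<open>N1 * totient d\<close> values of \<open>t\<close>.
\<close>

section \<open>Cycle decompositions as disjoint unions of standard cycles\<close>

text \<open>Arcs are pairs of vertices, so \<open>f\<close> alone determines the arc map
  \<open>map_prod f f\<close>. As arcs of \<open>G\<close> join vertices of \<open>G\<close>,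
  injectivity passes from vertices to arcs.\<close>

lemma pair_digraph_isoI:
  assumes bij: "bij_betw f (pverts G) (pverts H)"
    and arcs: "parcs H = map_prod f f ` parcs G"
    and wf: "parcs G \<subseteq> pverts G \<times> pverts G"
  shows "digraph_iso (with_proj G) (with_proj H)"
proof -
  let ?hom = "\<lparr>iso_verts = f, iso_arcs = map_prod f f, iso_head = snd, iso_tail = fst\<rparr>"
  have inj: "inj_on f (pverts G)"
    using bij by (simp add: bij_betw_def)
  have "inj_on (map_prod f f) (parcs G)"
    using map_prod_inj_on[OF inj inj] wf by (rule inj_on_subset)
  moreover have "wf_digraph (with_proj G)"
    using wf by unfold_locales auto
  ultimately have "pre_digraph.digraph_isomorphism (with_proj G) ?hom"
    using inj by (auto simp: pre_digraph.digraph_isomorphism_def)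
  moreover have "with_proj H = app_iso ?hom (with_proj G)"
    using bij arcs by (simp add: app_iso_def with_proj_def bij_betw_def)
  ultimately show ?thesis
    unfolding digraph_iso_def by blast
qed

text \<open>The first return time \<open>funpow_dist1 f x x\<close> enumerates the orbit without
  repetition, hence equals its cardinality.\<close>

lemma bij_betw_funpow_orbit:
  assumes "x \<in> orbit f x"
  shows "bij_betw (\<lambda>k. (f ^^ k) x) {..<card (orbit f x)} (orbit f x)"
    and "(f ^^ card (orbit f x)) x = x"
proof -
  let ?d = "funpow_dist1 f x x"
  have bij: "bij_betw (\<lambda>k. (f ^^ k) x) {0..<?d} (orbit f x)"
    unfolding bij_betw_def
    using inj_on_funpow_dist1[OF assms] orbit_conv_funpow_dist1[OF assms] by simp
  then have "card (orbit f x) = ?d"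
    using bij_betw_same_card by fastforce
  then show "bij_betw (\<lambda>k. (f ^^ k) x) {..<card (orbit f x)} (orbit f x)"
    and "(f ^^ card (orbit f x)) x = x"
    using bij funpow_dist1_prop[OF assms] by (simp_all add: atLeast0LessThan)
qed

text \<open>The orbit length is itself a period, so \<open>p\<close> divides it. Were
  \<open>p\<close> smaller, the exponents \<open>0\<close> and \<open>p\<close> would give the same
  point, although iterates below the orbit length are distinct.\<close>

lemma card_orbitI:
  assumes "p > 0" and "\<And>k. (f ^^ k) x = x \<longleftrightarrow> p dvd k"
  shows "card (orbit f x) = p"
proof -
  have self: "x \<in> orbit f x"
    using assms(1) assms(2)[of p] unfolding orbit_altdef by (auto intro!: exI[of _ p])
  have "finite (orbit f x)"
    using self by (rule finite_orbit)
  then have pos: "card (orbit f x) > 0"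
    using orbit_nonempty[of f x] by (simp add: card_gt_0_iff)
  have "p dvd card (orbit f x)"
    using bij_betw_funpow_orbit(2)[OF self] assms(2) by blast
  then have "p \<le> card (orbit f x)"
    using pos by (rule dvd_imp_le)
  moreover have "\<not> p < card (orbit f x)"
  proof
    assume "p < card (orbit f x)"
    then show False
      using bij_betw_funpow_orbit(1)[OF self] assms(1) assms(2)[of p]
      by (auto simp: bij_betw_def dest!: inj_onD[of _ _ p 0])
  qed
  ultimately show ?thesis by simp
qed

text \<open>\<open>D\<close> sorts the orbits into types: those of type \<open>i\<close> have length
  \<open>l i\<close> and number \<open>k i\<close>. Numbering the orbits of each type and choosing a
  base point in each gives coordinates on the vertices.\<close>

lemma cycle_decomposition_isoI:
  assumes perm: "\<pi> permutes A" and fin: "finite A"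
    and D: "\<And>X. X \<in> orbit \<pi> ` A \<Longrightarrow> D X \<in> I"
    and len: "\<And>X. X \<in> orbit \<pi> ` A \<Longrightarrow> card X = l (D X)"
    and num: "\<And>i. i \<in> I \<Longrightarrow> card {X \<in> orbit \<pi> ` A. D X = i} = k i"
  shows "digraph_iso (with_proj (cycle_decomposition \<pi> A))
    (with_proj (disjoint_union I (\<lambda>i. copies (k i) (Cyc (l i)))))"
proof -
  let ?O = "orbit \<pi> ` A"
  let ?G = "disjoint_union I (\<lambda>i. copies (k i) (Cyc (l i)))"
  have "\<exists>h. \<forall>i\<in>I. bij_betw (h i) {..<k i} {X \<in> ?O. D X = i}"
  proof (intro bchoice ballI)
    fix i assume "i \<in> I"
    then show "\<exists>h. bij_betw h {..<k i} {X \<in> ?O. D X = i}"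
      using ex_bij_betw_nat_finite[of "{X \<in> ?O. D X = i}"] fin num
      by (simp add: atLeast0LessThan)
  qed
  then obtain h where h: "\<And>i. i \<in> I \<Longrightarrow> bij_betw (h i) {..<k i} {X \<in> ?O. D X = i}"
    by blast
  have hO: "h i j \<in> ?O" "D (h i j) = i" if "i \<in> I" "j < k i" for i j
    using bij_betwE[OF h[OF that(1)]] that(2) by auto
  define r where "r X = (SOME x. x \<in> X)" for X :: "'a set"
  have cyc: "cyclic_on \<pi> X" if "X \<in> ?O" for X
    using that perm fin by (auto intro: cyclic_on_orbit)
  have r: "r X \<in> X" if "X \<in> ?O" for X
    using that orbit_nonempty[of \<pi>] unfolding r_def some_in_eq by auto
  have orb: "orbit \<pi> (r X) = X" if "X \<in> ?O" for X
    using orbit_cyclic_eq3[OF cyc[OF that] r[OF that]] .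
  have bij: "bij_betw (\<lambda>e. (\<pi> ^^ e) (r X)) {..<card X} X"
    and per: "(\<pi> ^^ card X) (r X) = r X" if "X \<in> ?O" for X
    using bij_betw_funpow_orbit[of "r X" \<pi>] r[OF that] orb[OF that] by simp_all
  \<comment> \<open>The vertex \<open>e\<close> of copy \<open>j\<close> of type \<open>i\<close>
    goes to the \<open>e\<close>-th iterate of the base point of the \<open>j\<close>-th orbit of
    that type.\<close>
  define F where "F = (\<lambda>(i, j, e). (h i j, (\<pi> ^^ e) (r (h i j))))"
  have verts: "pverts ?G = {(i, j, e). i \<in> I \<and> j < k i \<and> e < l i}"
    by (auto simp: disjoint_union_def copies_def Cyc_def)
  have arcs: "parcs ?G = {((i, j, e), (i, j, (e + 1) mod l i)) | i j e. i \<in> I \<and> j < k i \<and> e < l i}"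
    by (auto simp: disjoint_union_def copies_def Cyc_def)
  have l: "card (h i j) = l i" if "i \<in> I" "j < k i" for i j
    using hO[OF that] len by metis
  have F_bij: "bij_betw F (pverts ?G) (pverts (cycle_decomposition \<pi> A))"
    unfolding bij_betw_def
  proof
    show "inj_on F (pverts ?G)"
    proof (rule inj_onI)
      fix u v assume u: "u \<in> pverts ?G" and v: "v \<in> pverts ?G" and eq: "F u = F v"
      obtain i j e i' j' e' where uv: "u = (i, j, e)" "v = (i', j', e')"
        by (metis prod_cases3)
      have ij: "i \<in> I" "j < k i" "e < l i" "i' \<in> I" "j' < k i'" "e' < l i'"
        using u v uv unfolding verts by auto
      have X: "h i j = h i' j'" and e: "(\<pi> ^^ e) (r (h i j)) = (\<pi> ^^ e') (r (h i j))"
        using eq uv unfolding F_def by auto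
      have i: "i = i'"
        using hO ij X by metis
      have "j = j'"
        using h[OF ij(1)] X ij i by (auto simp: bij_betw_def dest: inj_onD)
      moreover have "e = e'"
        using bij[OF hO(1)[OF ij(1,2)]] e ij i l[OF ij(1,2)]
        by (auto simp: bij_betw_def dest: inj_onD)
      ultimately show "u = v" using uv i by simp
    qed
    show "F ` pverts ?G = pverts (cycle_decomposition \<pi> A)"
    proof (intro equalityI subsetI)
      fix v assume "v \<in> F ` pverts ?G"
      then obtain i j e where ij: "i \<in> I" "j < k i" "e < l i"
        and v: "v = (h i j, (\<pi> ^^ e) (r (h i j)))"
        unfolding verts F_def by auto
      have "(\<pi> ^^ e) (r (h i j)) \<in> h i j"
        using cyc hO r ij by (intro cyclic_on_funpow_in) auto
      then show "v \<in> pverts (cycle_decomposition \<pi> A)"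
        using hO ij v by (simp add: cycle_decomposition_def disjoint_union_def cycle_on_def)
    next
      fix v assume "v \<in> pverts (cycle_decomposition \<pi> A)"
      then obtain X x where v: "v = (X, x)" and X: "X \<in> ?O" and x: "x \<in> X"
        unfolding cycle_decomposition_def disjoint_union_def cycle_on_def by auto
      have "X \<in> h (D X) ` {..<k (D X)}"
        using h[OF D[OF X]] X unfolding bij_betw_def by simp
      then obtain j where j: "j < k (D X)" "X = h (D X) j"
        by auto
      have "x \<in> (\<lambda>e. (\<pi> ^^ e) (r X)) ` {..<card X}"
        using bij[OF X] x unfolding bij_betw_def by simp
      then obtain e where e: "e < l (D X)" "x = (\<pi> ^^ e) (r X)"
        using len[OF X] by auto
      have "v = F (D X, j, e)"
        using v j e unfolding F_def by simp
      moreover have "(D X, j, e) \<in> pverts ?G"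
        unfolding verts using D[OF X] j e by simp
      ultimately show "v \<in> F ` pverts ?G" by blast
    qed
  qed
  \<comment> \<open>At \<open>e + 1 = l i\<close> the standard cycle wraps around to
    \<open>0\<close>, which matches the return of the orbit to its base point.\<close>
  have step: "(\<pi> ^^ ((e + 1) mod l i)) (r (h i j)) = \<pi> ((\<pi> ^^ e) (r (h i j)))"
    if "i \<in> I" "j < k i" "e < l i" for i j e
  proof (cases "e + 1 = l i")
    case True
    then have "(\<pi> ^^ (e + 1)) (r (h i j)) = r (h i j)"
      using per[OF hO(1)[OF that(1,2)]] l[OF that(1,2)] by simp
    then show ?thesis using True by simp
  next
    case False
    then show ?thesis using that(3) by simp
  qed
  have arcs_G: "parcs ?G = (\<lambda>(i, j, e). ((i, j, e), (i, j, (e + 1) mod l i))) ` pverts ?G"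
    unfolding arcs verts by (auto simp: image_iff)
  have arcs_cd: "parcs (cycle_decomposition \<pi> A)
      = (\<lambda>(X, x). ((X, x), (X, \<pi> x))) ` pverts (cycle_decomposition \<pi> A)"
    unfolding cycle_decomposition_def disjoint_union_def cycle_on_def by (auto simp: image_iff)
  have "parcs (cycle_decomposition \<pi> A) = (\<lambda>(X, x). ((X, x), (X, \<pi> x))) ` F ` pverts ?G"
    unfolding arcs_cd using F_bij by (simp add: bij_betw_def)
  also have "\<dots> = map_prod F F ` parcs ?G"
    unfolding arcs_G image_image
  proof (rule image_cong[OF refl])
    fix u assume "u \<in> pverts ?G"
    then obtain i j e where u: "u = (i, j, e)" and ij: "i \<in> I" "j < k i" "e < l i"
      unfolding verts by auto
    show "(case F u of (X, x) \<Rightarrow> ((X, x), (X, \<pi> x)))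
        = map_prod F F (case u of (i, j, e) \<Rightarrow> ((i, j, e), (i, j, (e + 1) mod l i)))"
      using step[OF ij] by (simp add: u F_def)
  qed
  finally have arcs_F: "parcs (cycle_decomposition \<pi> A) = map_prod F F ` parcs ?G" .
  have wf: "parcs ?G \<subseteq> pverts ?G \<times> pverts ?G"
    unfolding arcs verts by auto
  \<comment> \<open>\<open>F\<close> leads from the standard cycles to the decomposition, so the
    isomorphism has to be reversed at the end.\<close>
  have "digraph_iso (with_proj ?G) (with_proj (cycle_decomposition \<pi> A))"
    using F_bij arcs_F wf by (rule pair_digraph_isoI)
  moreover have "wf_digraph (with_proj ?G)"
    using wf by unfold_locales auto
  ultimately show ?thesis
    by (rule digraph_iso_swap[rotated])
qed



section \<open>Iterates of affine maps modulo an integer\<close>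

text \<open>Complementation \<open>x\<close> to \<open>N div x\<close> on the divisors of
  \<open>N\<close> turns the condition into a prescribed gcd, for which the count is a
  totient.\<close>

lemma card_div_gcd_eq_totient:
  fixes N d :: nat
  assumes "N > 0" "d dvd N"
  shows "card {r \<in> {..<N}. N div gcd N r = d} = totient d"
proof -
  have iff: "N div gcd N r = d \<longleftrightarrow> gcd r N = N div d" for r
  proof -
    have "N div (N div x) = x" if "x dvd N" for x
      using that assms(1) by (auto elim!: dvdE)
    then show ?thesis
      using assms(2) by (metis gcd.commute gcd_dvd1)
  qed
  \<comment> \<open>The known count runs over \<open>1\<close> to \<open>N\<close>; the residues
    here run from \<open>0\<close>, which takes the place of \<open>N\<close>.\<close>
  have "bij_betw (\<lambda>r. r mod N) {r \<in> {0<..N}. gcd r N = N div d} {r \<in> {..<N}. gcd r N = N div d}"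
  proof (rule bij_betw_byWitness[where f' = "\<lambda>r. if r = 0 then N else r"])
    show "\<forall>r\<in>{r \<in> {0<..N}. gcd r N = N div d}. (if r mod N = 0 then N else r mod N) = r"
      using assms by (auto simp: le_less dvd_imp_le dest: dvd_imp_le)
    show "\<forall>r\<in>{r \<in> {..<N}. gcd r N = N div d}. (if r = 0 then N else r) mod N = r"
      by auto
    show "(\<lambda>r. r mod N) ` {r \<in> {0<..N}. gcd r N = N div d} \<subseteq> {r \<in> {..<N}. gcd r N = N div d}"
      using assms by (auto simp: gcd.commute[of _ N] gcd_mod_right)
    show "(\<lambda>r. if r = 0 then N else r) ` {r \<in> {..<N}. gcd r N = N div d}
        \<subseteq> {r \<in> {0<..N}. gcd r N = N div d}"
      using assms by auto
  qed
  from bij_betw_same_card[OF this]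
  have "card {r \<in> {..<N}. gcd r N = N div d} = card {r \<in> {0<..N}. gcd r N = N div d}"
    by simp
  also have "\<dots> = totient d"
    using card_gcd_eq_totient[of N "N div d"] assms by auto
  finally show ?thesis
    unfolding iff .
qed

text \<open>As \<open>q\<close> is invertible modulo \<open>N2\<close>, the quotient
  \<open>t div N2\<close> and the residue of \<open>q * t + v\<close> are independent coordinates
  for \<open>t\<close>. The condition concerns only the second; the first contributes the factor
  \<open>N1\<close>.\<close>

lemma card_affine_gcd:
  fixes q v N1 N2 d :: nat
  assumes q: "coprime q N2" and N2: "N2 > 0" and d: "d dvd N2"
  shows "card {t \<in> {..<N1 * N2}. N2 div gcd N2 (q * t + v) = d} = N1 * totient d"
proof -
  define F where "F t = (t div N2, (q * t + v) mod N2)" for t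
  let ?R = "{r \<in> {..<N2}. N2 div gcd N2 r = d}"
  have inj: "inj_on F {..<N1 * N2}"
  proof (rule inj_onI)
    fix t t' assume "F t = F t'"
    then have div: "t div N2 = t' div N2" and "[q * t + v = q * t' + v] (mod N2)"
      by (simp_all add: F_def cong_def)
    then have "[t = t'] (mod N2)"
      using q by (simp add: cong_add_rcancel_nat cong_mult_lcancel_nat)
    then show "t = t'"
      using div by (metis cong_def div_mult_mod_eq)
  qed
  have sub: "F ` {..<N1 * N2} \<subseteq> {..<N1} \<times> {..<N2}"
    using N2 by (auto simp: F_def less_mult_imp_div_less)
  \<comment> \<open>An injection between finite sets of the same size \<open>N1 * N2\<close> is
    onto.\<close>
  then have img: "F ` {..<N1 * N2} = {..<N1} \<times> {..<N2}"
    by (intro card_subset_eq) (auto simp: card_image[OF inj])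
  have snd_F: "gcd N2 (snd (F t)) = gcd N2 (q * t + v)" for t
    by (simp add: F_def gcd_mod_right N2)
  have "F ` {t \<in> {..<N1 * N2}. N2 div gcd N2 (q * t + v) = d}
      = {y \<in> F ` {..<N1 * N2}. N2 div gcd N2 (snd y) = d}"
    using snd_F by auto
  also have "\<dots> = {..<N1} \<times> ?R"
    unfolding img by auto
  finally have "card (F ` {t \<in> {..<N1 * N2}. N2 div gcd N2 (q * t + v) = d}) = N1 * card ?R"
    by (simp add: card_cartesian_product)
  moreover have "card (F ` {t \<in> {..<N1 * N2}. N2 div gcd N2 (q * t + v) = d})
      = card {t \<in> {..<N1 * N2}. N2 div gcd N2 (q * t + v) = d}"
    by (rule card_image[OF inj_on_subset[OF inj]]) auto
  ultimately show ?thesis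
    using card_div_gcd_eq_totient[OF N2 d] by simp
qed

section \<open>Divisibility and multiplicative orders\<close>

lemma common_prime_divisor_nat:
  fixes a b :: nat
  assumes "\<not> coprime a b"
  obtains p where "prime p" "p dvd a" "p dvd b"
  using prime_factor_nat[of "gcd a b"] assms unfolding coprime_iff_gcd_eq_1 gcd_greatest_iff by blast

text \<open>A prime dividing both \<open>N\<close> and \<open>u\<close> would divide
  \<open>rad N\<close>, hence \<open>q\<close>, against coprimality of \<open>q\<close> and
  \<open>u\<close>.\<close>

lemma coprime_if_rad_dvd:
  assumes "N > 0" "rad N dvd q" "coprime q u"
  shows "coprime N u"
proof (rule ccontr)
  assume "\<not> coprime N u"
  then obtain p where p: "prime p" "p dvd N" "p dvd u"
    by (rule common_prime_divisor_nat)
  then have "p \<in> prime_factors N"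
    using assms(1) by (simp add: prime_factors_dvd)
  then have "p dvd rad N"
    unfolding rad_def by (metis dvd_prodI finite_set_mset)
  then have "p dvd q"
    using assms(2) by (rule dvd_trans)
  then show False
    using p assms(3) by (meson coprime_common_divisor not_prime_unit)
qed

lemma power_minus_one_eq_sum:
  fixes P k :: nat
  assumes "P > 0"
  shows "P ^ k - 1 = (P - 1) * (\<Sum>j<k. P ^ j)"
proof -
  have "int (P ^ k - 1) = int ((P - 1) * (\<Sum>j<k. P ^ j))"
    using assms power_diff_1_eq[of "int P" k] by (simp add: of_nat_diff)
  then show ?thesis by linarith
qed

text \<open>The left side says that the \<open>k\<close>-th iterate of the map sending
  \<open>t\<close> to \<open>P * t + s\<close> moves \<open>t\<close> by a multiple of
  \<open>N1 * N2\<close>. The geometric sum makes this displacement a multiple of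
  \<open>u = q * t + s div g\<close>, and all of \<open>u\<close> except its common factor with
  \<open>N2\<close> is coprime to the modulus.\<close>

lemma dvd_affine_iff_ord_dvd:
  fixes P s N1 N2 t k :: nat
  defines "g \<equiv> gcd s (P - 1)"
  defines "q \<equiv> (P - 1) div g"
  defines "d \<equiv> N2 div gcd N2 (q * t + s div g)"
  assumes P: "P > 1" and N1: "N1 > 0" and N2: "N2 > 0"
    and rad: "rad N1 dvd q" and q_N2: "coprime q N2"
  shows "N1 * N2 dvd (P ^ k - 1) * t + s * (\<Sum>j<k. P ^ j) \<longleftrightarrow> ord (N1 * q * d) P dvd k"
proof -
  let ?u = "q * t + s div g" and ?\<Sigma> = "\<Sum>j<k. P ^ j"
  have g: "g > 0" "g dvd s" "g dvd P - 1"
    using P by (auto simp: g_def)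
  have gq: "g * q = P - 1" and gs: "g * (s div g) = s"
    using g by (simp_all add: q_def)
  have q: "q > 0"
    using gq P by (intro gr0I) auto
  have "coprime (s div g) q"
    unfolding q_def g_def using P by (intro div_gcd_coprime) auto
  then have q_u: "coprime q ?u"
    using gcd_add_mult[of q t "s div g"]
    by (simp only: coprime_iff_gcd_eq_1 gcd.commute[of _ q] mult.commute[of q])
  have N1_u: "coprime N1 ?u"
    using coprime_if_rad_dvd[OF N1 rad q_u] .
  define e where "e = gcd N2 ?u"
  have e: "e > 0" "N2 = d * e"
    using N2 by (auto simp: e_def d_def)
  \<comment> \<open>\<open>N2 = d * e\<close> and \<open>u = w * e\<close> have gcd exactly
    \<open>e\<close>, so the cofactors \<open>d\<close> and \<open>w\<close> are coprime.\<close>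
  obtain w where w: "?u = w * e"
    unfolding e_def by (metis gcd_dvd2 dvd_def mult.commute)
  have "coprime d w"
  proof -
    have "e * gcd d w = gcd (e * d) (e * w)"
      by (rule gcd_mult_distrib_nat)
    also have "e * d = N2"
      using e(2) by (simp only: mult.commute)
    also have "e * w = ?u"
      using w by (simp only: mult.commute)
    finally have "e * gcd d w = e * 1"
      unfolding mult_1_right e_def[symmetric] .
    then show ?thesis
      using e(1) unfolding coprime_iff_gcd_eq_1 by (simp only: nat_mult_eq_cancel1)
  qed
  moreover have "coprime N1 w" "coprime q w"
    using N1_u q_u unfolding w by simp_all
  ultimately have cop: "coprime (N1 * q * d) w"
    by simp
  have pow: "P ^ k - 1 = (g * q) * ?\<Sigma>"
    using power_minus_one_eq_sum[of P k] P gq by simp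
  have "(P ^ k - 1) * t + s * ?\<Sigma> = (g * q) * ?\<Sigma> * t + (g * (s div g)) * ?\<Sigma>"
    unfolding pow gs ..
  also have "\<dots> = ?\<Sigma> * g * ?u"
    by (simp only: algebra_simps)
  finally have "(P ^ k - 1) * t + s * ?\<Sigma> = ?\<Sigma> * g * ?u" .
  \<comment> \<open>Multiplying by the positive \<open>q\<close> completes \<open>g\<close> times
    the geometric sum to \<open>P ^ k - 1\<close>.\<close>
  moreover have "N1 * N2 dvd ?\<Sigma> * g * ?u \<longleftrightarrow> q * (N1 * N2) dvd q * (?\<Sigma> * g * ?u)"
    using q by simp
  moreover have "q * (?\<Sigma> * g * ?u) = (P ^ k - 1) * ?u"
    unfolding pow by (simp only: ac_simps)
  moreover have "q * (N1 * N2) dvd (P ^ k - 1) * ?u \<longleftrightarrow> N1 * q * d dvd P ^ k - 1"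
  proof -
    have "q * (N1 * N2) dvd (P ^ k - 1) * ?u \<longleftrightarrow> (N1 * q * d) * e dvd ((P ^ k - 1) * w) * e"
      unfolding w e(2) by (simp only: ac_simps)
    also have "\<dots> \<longleftrightarrow> N1 * q * d dvd P ^ k - 1"
      using e(1) cop by (simp add: coprime_dvd_mult_left_iff)
    finally show ?thesis .
  qed
  moreover have "N1 * q * d dvd P ^ k - 1 \<longleftrightarrow> ord (N1 * q * d) P dvd k"
    using P by (simp add: ord_divides[symmetric] cong_altdef_nat)
  ultimately show ?thesis by simp
qed

section \<open>Piecewise affine permutations and their first return map\<close>

lemma Psi_in: "k > 0 \<Longrightarrow> Psi k x \<in> {1..k}"
  by (auto simp: Psi_eq less_imp_le mod_greater_zero_iff_not_dvd Suc_le_eq)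

lemma cong_Psi: "k > 0 \<Longrightarrow> [Psi k x = x] (mod k)"
  by (simp add: Psi_eq cong_def)

lemma cong_imp_eq_atLeastAtMost:
  fixes x y k :: nat
  assumes "[x = y] (mod k)" "x \<in> {1..k}" "y \<in> {1..k}"
  shows "x = y"
  using assms by (cases "x = k"; cases "y = k") (auto simp: cong_def)

lemma Psi_eq_iff: "k > 0 \<Longrightarrow> Psi k x = Psi k y \<longleftrightarrow> [x = y] (mod k)"
  using cong_Psi[of k x] cong_Psi[of k y] cong_imp_eq_atLeastAtMost[OF _ Psi_in Psi_in]
  by (auto simp: cong_def)

lemma Psi_id: "x \<in> {1..k} \<Longrightarrow> Psi k x = x"
  by (rule cong_imp_eq_atLeastAtMost[OF cong_Psi Psi_in]) auto

lemma Psi_eq_self_iff: "k > 0 \<Longrightarrow> Psi k x = k \<longleftrightarrow> k dvd x"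
  by (auto simp: Psi_eq dest: mod_less_divisor[of k x])

lemma Psi_Psi_add: "k > 0 \<Longrightarrow> Psi k (Psi k x + y) = Psi k (x + y)"
  by (simp add: Psi_eq_iff cong_add cong_Psi)

lemma bij_betw_Psi_add:
  assumes "k > 0"
  shows "bij_betw (\<lambda>j. Psi k (i + j)) {..<k} {1..k}"
proof -
  have inj: "inj_on (\<lambda>j. Psi k (i + j)) {..<k}"
    using assms
    by (auto intro!: inj_onI simp: Psi_eq_iff cong_add_lcancel_nat dest: cong_less_modulus_unique_nat)
  moreover have "(\<lambda>j. Psi k (i + j)) ` {..<k} = {1..k}"
    using assms Psi_in by (intro card_subset_eq) (auto simp: card_image[OF inj])
  ultimately show ?thesis
    by (simp add: bij_betw_def)
qed

section \<open>Iterates of a piecewise affine permutation\<close>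

locale pap =
  fixes n m :: nat and \<pi> a b c :: "nat \<Rightarrow> nat"
  assumes m: "m > 0" and n: "n > 0" and m_dvd_n: "m dvd n"
    and is_pap: "is_pap n m \<pi> a b c"
begin

lemma permutes: "\<pi> permutes {1..n}"
  using is_pap by (simp add: is_pap_def)

lemma c_bij: "bij_betw c {1..m} {1..m}"
  using is_pap by (simp add: is_pap_def perm_vectors_def)

lemma pap_step:
  assumes "x \<in> {1..n}" "i \<in> {1..m}" "Psi m x = c i"
  shows "\<pi> x = Psi n (a i * x + b i)" "Psi m (\<pi> x) = c (Psi m (i + 1))"
  using is_pap assms unfolding is_pap_def by blast+

lemma funpow_in: "x \<in> {1..n} \<Longrightarrow> (\<pi> ^^ k) x \<in> {1..n}"
  using permutes by (induction k) (simp_all add: permutes_in_image del: atLeastAtMost_iff)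

lemma Psi_funpow:
  assumes "x \<in> {1..n}" "i \<in> {1..m}" "Psi m x = c i"
  shows "Psi m ((\<pi> ^^ k) x) = c (Psi m (i + k))"
proof (induction k)
  case 0
  then show ?case using assms by (simp add: Psi_id)
next
  case (Suc k)
  show ?case
    using pap_step(2)[OF funpow_in[OF assms(1)] Psi_in[OF m] Suc]
    using Psi_Psi_add[OF m, of "i + k" 1] by simp
qed

text \<open>All points of one residue class pass through the same classes in the same order, so the
  same affine pieces are composed for them. The slope is explicit, while of the constant term
  \<open>B\<close> only independence of \<open>x\<close> matters.\<close>

lemma funpow_affine:
  assumes i: "i \<in> {1..m}"
  shows "\<exists>B. \<forall>x\<in>{1..n}. Psi m x = c i \<longrightarrow>
    [(\<pi> ^^ k) x = (\<Prod>j<k. a (Psi m (i + j))) * x + B] (mod n)"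
proof (induction k)
  case 0
  show ?case by (rule exI[of _ 0]) simp
next
  case (Suc k)
  let ?i = "Psi m (i + k)"
  obtain B where B: "\<And>x. x \<in> {1..n} \<Longrightarrow> Psi m x = c i \<Longrightarrow>
      [(\<pi> ^^ k) x = (\<Prod>j<k. a (Psi m (i + j))) * x + B] (mod n)"
    using Suc by blast
  show ?case
  proof (intro exI[of _ "a ?i * B + b ?i"] ballI impI)
    fix x assume x: "x \<in> {1..n}" "Psi m x = c i"
    have "(\<pi> ^^ Suc k) x = Psi n (a ?i * (\<pi> ^^ k) x + b ?i)"
      using pap_step(1)[OF funpow_in[OF x(1)] Psi_in[OF m] Psi_funpow[OF x(1) i x(2)]] by simp
    also have "[\<dots> = a ?i * (\<pi> ^^ k) x + b ?i] (mod n)"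
      using n by (rule cong_Psi)
    also have "[a ?i * (\<pi> ^^ k) x + b ?i
        = a ?i * ((\<Prod>j<k. a (Psi m (i + j))) * x + B) + b ?i] (mod n)"
      by (intro cong_add cong_mult B x cong_refl)
    also have "a ?i * ((\<Prod>j<k. a (Psi m (i + j))) * x + B) + b ?i
        = (\<Prod>j<Suc k. a (Psi m (i + j))) * x + (a ?i * B + b ?i)"
      by (simp add: algebra_simps)
    finally show "[(\<pi> ^^ Suc k) x
        = (\<Prod>j<Suc k. a (Psi m (i + j))) * x + (a ?i * B + b ?i)] (mod n)" .
  qed
qed

text \<open>Any \<open>m\<close> cyclically consecutive indices exhaust all indices, so the slope of
  the \<open>m\<close>-th iterate is the same on every class.\<close>

lemma principal_product_cyclic: "(\<Prod>j<m. a (Psi m (i + j))) = principal_product m a"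
  unfolding principal_product_def by (rule prod.reindex_bij_betw[OF bij_betw_Psi_add[OF m]])

lemma obtain_index:
  obtains i where "i \<in> {1..m}" "c i = Psi m x"
  using c_bij Psi_in[OF m, of x] unfolding bij_betw_def by (metis imageE)

text \<open>Each step advances the index of the class by one modulo \<open>m\<close>, and
  \<open>c\<close> is injective, so the class of multiples of \<open>m\<close> recurs with period
  exactly \<open>m\<close>.\<close>

lemma dvd_funpow_iff:
  assumes "x \<in> {1..n}" "m dvd x"
  shows "m dvd (\<pi> ^^ k) x \<longleftrightarrow> m dvd k"
proof -
  obtain i where i: "i \<in> {1..m}" "c i = Psi m x"
    by (rule obtain_index)
  have "c i = m"
    using i assms by (simp add: Psi_eq_self_iff m)
  have "m dvd (\<pi> ^^ k) x \<longleftrightarrow> c (Psi m (i + k)) = c i"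
    using Psi_funpow[of x i k] i assms \<open>c i = m\<close> by (simp add: Psi_eq_self_iff[OF m, symmetric])
  also have "\<dots> \<longleftrightarrow> Psi m (i + k) = Psi m (i + 0)"
    using c_bij i(1) Psi_in[OF m] by (auto simp: bij_betw_def Psi_id inj_on_eq_iff)
  also have "\<dots> \<longleftrightarrow> m dvd k"
    unfolding Psi_eq_iff[OF m] cong_add_lcancel_nat by (simp add: cong_0_iff)
  finally show ?thesis .
qed

lemma reaches_multiple:
  assumes "x \<in> {1..n}"
  obtains k where "m dvd (\<pi> ^^ k) x"
proof -
  obtain i where i: "i \<in> {1..m}" "c i = Psi m x"
    by (rule obtain_index)
  obtain i0 where i0: "i0 \<in> {1..m}" "c i0 = Psi m m"
    by (rule obtain_index)
  \<comment> \<open>Adding \<open>m\<close> keeps the subtraction of \<open>i \<le> m\<close> from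
    being truncated; modulo \<open>m\<close> the index moves from \<open>i\<close> to
    \<open>i0\<close>.\<close>
  have "Psi m (i + (m + i0 - i)) = Psi m (m + i0)"
    using i i0 by simp
  also have "\<dots> = Psi m i0"
    by (simp add: Psi_eq_iff m cong_def)
  also have "\<dots> = i0"
    using i0 by (simp add: Psi_id)
  finally have "Psi m ((\<pi> ^^ (m + i0 - i)) x) = m"
    using Psi_funpow[OF assms i(1)] i(2) i0 by (simp add: Psi_eq_self_iff m)
  then have "m dvd (\<pi> ^^ (m + i0 - i)) x"
    by (simp add: Psi_eq_self_iff m)
  then show thesis by (rule that)
qed

text \<open>Justifies the definite description of the principal sum: a suitable value is the
  constant term of the \<open>m\<close>-th iterate, reduced to the range from \<open>1\<close> to
  \<open>n\<close>.\<close>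

lemma principal_sum_spec:
  shows principal_sum_in: "principal_sum n m \<pi> a \<in> {1..n}"
    and principal_sum_cong: "\<And>x. x \<in> {1..n} \<Longrightarrow> m dvd x \<Longrightarrow>
      [(\<pi> ^^ m) x = principal_product m a * x + principal_sum n m \<pi> a] (mod n)"
proof -
  let ?P = "principal_product m a"
  let ?Q = "\<lambda>S. S \<in> {1..n} \<and>
    (\<forall>x\<in>{1..n}. [x = 0] (mod m) \<longrightarrow> (\<pi> ^^ m) x = Psi n (?P * x + S))"
  obtain i where i: "i \<in> {1..m}" "c i = Psi m m"
    by (rule obtain_index)
  obtain B where B: "\<And>x. x \<in> {1..n} \<Longrightarrow> Psi m x = c i \<Longrightarrow> [(\<pi> ^^ m) x = ?P * x + B] (mod n)"
    using funpow_affine[OF i(1), of m] unfolding principal_product_cyclic by blast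
  have "\<exists>!S. ?Q S"
  proof (rule ex1I[of _ "Psi n B"])
    show "?Q (Psi n B)"
    proof (intro conjI ballI impI)
      fix x assume x: "x \<in> {1..n}" "[x = 0] (mod m)"
      then have "[(\<pi> ^^ m) x = ?P * x + B] (mod n)"
        using i by (intro B) (simp_all add: Psi_eq_iff[OF m] Psi_eq_self_iff[OF m] cong_0_iff cong_def)
      also have "[?P * x + B = ?P * x + Psi n B] (mod n)"
        by (intro cong_add cong_refl cong_sym[OF cong_Psi[OF n]])
      also have "[?P * x + Psi n B = Psi n (?P * x + Psi n B)] (mod n)"
        by (rule cong_sym[OF cong_Psi[OF n]])
      finally show "(\<pi> ^^ m) x = Psi n (?P * x + Psi n B)"
        by (rule cong_imp_eq_atLeastAtMost[OF _ funpow_in[OF x(1)] Psi_in[OF n]])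
    qed (rule Psi_in[OF n])
  next
    fix S assume S: "?Q S"
    \<comment> \<open>At the argument \<open>n\<close> the linear term vanishes modulo
      \<open>n\<close>, so the constant term is determined.\<close>
    have "n \<in> {1..n}" "[n = 0] (mod m)"
      using n m_dvd_n by (simp_all add: cong_0_iff)
    then have "(\<pi> ^^ m) n = Psi n (?P * n + S)"
      using S by blast
    then have "[(\<pi> ^^ m) n = ?P * n + S] (mod n)"
      using cong_Psi[OF n] by metis
    moreover have "[(\<pi> ^^ m) n = ?P * n + B] (mod n)"
      using i n m_dvd_n Psi_eq_self_iff[OF m, of n] Psi_eq_self_iff[OF m, of m]
      by (intro B) simp_all
    ultimately have "[S = B] (mod n)"
      by (simp add: cong_def)
    then have "[S = Psi n B] (mod n)"
      by (rule cong_trans[OF _ cong_sym[OF cong_Psi[OF n]]])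
    then show "S = Psi n B"
      using S by (intro cong_imp_eq_atLeastAtMost[OF _ _ Psi_in[OF n]]) auto
  qed
  then have Q: "?Q (principal_sum n m \<pi> a)"
    unfolding principal_sum_def by (rule theI')
  then show "principal_sum n m \<pi> a \<in> {1..n}" by blast
  fix x assume "x \<in> {1..n}" "m dvd x"
  then have "(\<pi> ^^ m) x = Psi n (?P * x + principal_sum n m \<pi> a)"
    using Q by (simp add: cong_0_iff)
  then show "[(\<pi> ^^ m) x = ?P * x + principal_sum n m \<pi> a] (mod n)"
    using cong_Psi[OF n] by metis
qed

end

section \<open>The first return map to the multiples of \<open>m\<close>\<close>

locale principal_pap = pap +
  fixes N1 N2 P S g q :: nat
  assumes P_eq: "P = principal_product m a" and P: "P > 1"
    and S_eq: "S = principal_sum n m \<pi> a"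
    and g_eq: "g = gcd (S div m) (P - 1)" and q_eq: "q = (P - 1) div g"
    and N1N2: "n div m = N1 * N2"
    and rad_N1: "rad N1 dvd q" and q_N2: "coprime q N2"
begin

text \<open>The order of \<open>u = q * t + S div m div g\<close>, with \<open>t = x div m\<close>,
  in the additive group modulo \<open>N2\<close>. This is the divisor \<open>d\<close> of
  \<open>N2\<close> that indexes the cycle through a multiple \<open>x\<close> of
  \<open>m\<close>.\<close>

definition level :: "nat \<Rightarrow> nat" where
  "level x = N2 div gcd N2 (q * (x div m) + S div m div g)"

lemma n_eq: "n = m * (N1 * N2)"
  using N1N2 m_dvd_n by (metis dvd_mult_div_cancel)

lemma N1: "N1 > 0" and N2: "N2 > 0"
  using n n_eq by (auto intro!: gr0I)

lemma g_q: "g * q = P - 1" and g_dvd_S: "g dvd S div m"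
  by (simp_all add: g_eq q_eq)

lemma funpow_m_cong: "x \<in> {1..n} \<Longrightarrow> m dvd x \<Longrightarrow> [(\<pi> ^^ m) x = P * x + S] (mod n)"
  using principal_sum_cong by (simp add: P_eq S_eq)

text \<open>The \<open>m\<close>-th iterate sends \<open>n\<close> to a multiple of
  \<open>m\<close>, and modulo \<open>n\<close> this value is \<open>P * n + S\<close>.\<close>

lemma m_dvd_S: "m dvd S"
proof -
  have n_in: "n \<in> {1..n}" using n by simp
  have "[(\<pi> ^^ m) n = P * n + S] (mod n)"
    using n_in m_dvd_n by (rule funpow_m_cong)
  then have "[(\<pi> ^^ m) n = P * n + S] (mod m)"
    using m_dvd_n by (rule cong_dvd_modulus_nat)
  then have "m dvd P * n + S"
    using dvd_funpow_iff[OF n_in m_dvd_n, of m] by (simp add: cong_dvd_iff)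
  then show ?thesis
    using m_dvd_n by (simp add: dvd_add_right_iff)
qed

text \<open>A common prime factor \<open>p\<close> of \<open>P\<close> and \<open>n div m\<close> would identify the images of \<open>n\<close>
  and \<open>n div p\<close> under \<open>\<pi> ^^ m\<close>.\<close>

lemma coprime_P: "coprime P (N1 * N2)"
proof (rule ccontr)
  assume "\<not> coprime P (N1 * N2)"
  then obtain p where p: "prime p" "p dvd P" "p dvd N1 * N2"
    by (rule common_prime_divisor_nat)
  obtain M where M: "N1 * N2 = p * M"
    using p(3) by (rule dvdE)
  obtain R where R: "P = p * R"
    using p(2) by (rule dvdE)
  have M_pos: "M > 0"
    using M N1 N2 by (intro gr0I) auto
  have "1 < p" using p(1) by (rule prime_gt_1_nat)
  have n': "n = p * (m * M)"
    using n_eq M by (simp only: ac_simps)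
  have less: "m * M < n"
    unfolding n' using M_pos m \<open>1 < p\<close> by simp
  have in1: "m * M \<in> {1..n}"
    using less M_pos m by (simp add: Suc_le_eq)
  have in2: "n \<in> {1..n}"
    using n by simp
  have "P * (m * M) = R * n"
    unfolding n' R by (simp only: ac_simps)
  then have "[P * (m * M) + S = P * n + S] (mod n)"
    by (simp add: cong_def)
  then have "[(\<pi> ^^ m) (m * M) = (\<pi> ^^ m) n] (mod n)"
    using funpow_m_cong[OF in1] funpow_m_cong[OF in2 m_dvd_n]
    by (auto intro: cong_trans cong_sym)
  then have "(\<pi> ^^ m) (m * M) = (\<pi> ^^ m) n"
    by (rule cong_imp_eq_atLeastAtMost[OF _ funpow_in[OF in1] funpow_in[OF in2]])
  then have "m * M = n"
    using permutes_inj[OF permutes] by (metis inj_fn injD)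
  then show False
    using less by simp
qed

lemma level_dvd: "level x dvd N2"
  unfolding level_def by (metis dvd_div_mult_self dvd_triv_left gcd_dvd1)

text \<open>Ensures that the orders of \<open>P\<close> are positive; \<open>ord\<close> is
  \<open>0\<close> when the arguments are not coprime.\<close>

lemma coprime_P_eta:
  assumes "d dvd N2"
  shows "coprime (N1 * q * d) P"
proof -
  have "q dvd P - 1"
    using g_q by (metis dvd_triv_right)
  then have "coprime q P"
    using P coprime_diff_one_left_nat[of P] by (intro coprime_divisors[of q "P - 1" P P]) simp_all
  moreover have N: "coprime N1 P" "coprime N2 P"
    using coprime_P by (simp_all add: coprime_commute)
  moreover have "coprime d P"
    using assms dvd_refl N(2) by (rule coprime_divisors)
  ultimately show ?thesis by simp
qed

lemma funpow_mult_cong: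
  assumes "x \<in> {1..n}" "m dvd x"
  shows "[(\<pi> ^^ (m * k)) x = P ^ k * x + S * (\<Sum>j<k. P ^ j)] (mod n)"
proof (induction k)
  case 0
  show ?case by simp
next
  case (Suc k)
  let ?y = "(\<pi> ^^ (m * k)) x"
  have "(\<pi> ^^ (m * Suc k)) x = (\<pi> ^^ m) ?y"
    by (simp add: funpow_add)
  also have "[(\<pi> ^^ m) ?y = P * ?y + S] (mod n)"
    using assms by (intro funpow_m_cong funpow_in) (simp_all add: dvd_funpow_iff)
  also have "[P * ?y + S = P * (P ^ k * x + S * (\<Sum>j<k. P ^ j)) + S] (mod n)"
    by (intro cong_add cong_mult Suc cong_refl)
  also have "P * (P ^ k * x + S * (\<Sum>j<k. P ^ j)) + S = P ^ Suc k * x + S * (\<Sum>j<Suc k. P ^ j)"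
    \<comment> \<open>Splitting off the term for \<open>j = 0\<close> leaves \<open>P\<close> times
      the previous sum.\<close>
    unfolding sum.lessThan_Suc_shift by (simp add: algebra_simps sum_distrib_left)
  finally show ?case .
qed

text \<open>If \<open>m\<close> does not divide \<open>k\<close>, the iterate leaves the multiples
  of \<open>m\<close>. Otherwise the displacement is divided by \<open>m\<close>, and
  \<open>dvd_affine_iff_ord_dvd\<close> decides when it vanishes.\<close>

lemma funpow_fixed_iff:
  assumes x: "x \<in> {1..n}" "m dvd x"
  shows "(\<pi> ^^ k) x = x \<longleftrightarrow> m * ord (N1 * q * level x) P dvd k"
proof (cases "m dvd k")
  case False
  then show ?thesis
    using dvd_funpow_iff[OF x, of k] x(2) by (auto dest: dvd_mult_left)
next
  case True
  then obtain j where k: "k = m * j" by (rule dvdE)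
  let ?t = "x div m" and ?s = "S div m"
  have t: "x = m * ?t" and s: "S = m * ?s"
    using x(2) m_dvd_S by simp_all
  have "(\<pi> ^^ k) x = x \<longleftrightarrow> [(\<pi> ^^ k) x = x] (mod n)"
    using cong_imp_eq_atLeastAtMost[OF _ funpow_in[OF x(1)] x(1)] by auto
  also have "\<dots> \<longleftrightarrow> [P ^ j * x + S * (\<Sum>i<j. P ^ i) = x] (mod n)"
    using funpow_mult_cong[OF x, of j] unfolding k by (auto intro: cong_trans cong_sym)
  also have "P ^ j * x + S * (\<Sum>i<j. P ^ i) = x + m * ((P ^ j - 1) * ?t + ?s * (\<Sum>i<j. P ^ i))"
  proof -
    have "P ^ j * x = x + (P ^ j - 1) * x"
      using P by (simp add: diff_mult_distrib)
    moreover have "(P ^ j - 1) * x = m * ((P ^ j - 1) * ?t)"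
      using t by (metis mult.left_commute)
    moreover have "S * (\<Sum>i<j. P ^ i) = m * (?s * (\<Sum>i<j. P ^ i))"
      using s by (metis mult.assoc)
    ultimately show ?thesis
      by (simp only: distrib_left add.assoc)
  qed
  also have "[x + m * ((P ^ j - 1) * ?t + ?s * (\<Sum>i<j. P ^ i)) = x] (mod n) \<longleftrightarrow>
      m * (N1 * N2) dvd m * ((P ^ j - 1) * ?t + ?s * (\<Sum>i<j. P ^ i))"
    unfolding n_eq[symmetric] by (simp add: cong_add_lcancel_0_nat cong_0_iff)
  also have "\<dots> \<longleftrightarrow> N1 * N2 dvd (P ^ j - 1) * ?t + ?s * (\<Sum>i<j. P ^ i)"
    using m by simp
  also have "\<dots> \<longleftrightarrow> ord (N1 * q * level x) P dvd j"
    using dvd_affine_iff_ord_dvd[OF P N1 N2, of ?s j ?t] rad_N1 q_N2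
    unfolding g_eq[symmetric] q_eq[symmetric] level_def[symmetric] by blast
  finally show ?thesis
    using m by (simp add: k)
qed

lemma card_orbit:
  assumes "x \<in> {1..n}" "m dvd x"
  shows "card (orbit \<pi> x) = m * ord (N1 * q * level x) P"
  using m coprime_P_eta[OF level_dvd] funpow_fixed_iff[OF assms]
  by (intro card_orbitI) simp_all

text \<open>The return map multiplies \<open>u\<close> by \<open>P\<close> modulo \<open>N2\<close>,
  and multiplication by a unit preserves the gcd with \<open>N2\<close>.\<close>

lemma level_funpow_m:
  assumes x: "x \<in> {1..n}" "m dvd x"
  shows "level ((\<pi> ^^ m) x) = level x"
proof -
  let ?y = "(\<pi> ^^ m) x" and ?t = "x div m" and ?s = "S div m"
  let ?v = "?s div g"
  have "m dvd ?y"
    using dvd_funpow_iff[OF x] by simp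
  then have "[m * (?y div m) = P * (m * ?t) + m * ?s] (mod (m * (N1 * N2)))"
    using funpow_m_cong[OF x] x(2) m_dvd_S n_eq by simp
  then have "[m * (?y div m) = m * (P * ?t + ?s)] (mod (m * (N1 * N2)))"
    by (simp add: algebra_simps)
  then have "[?y div m = P * ?t + ?s] (mod (N1 * N2))"
    using m by (simp add: cong_def mult_mod_right[symmetric])
  then have "[?y div m = P * ?t + ?s] (mod N2)"
    by (rule cong_dvd_modulus_nat) simp
  then have "[q * (?y div m) + ?v = q * (P * ?t + ?s) + ?v] (mod N2)"
    by (intro cong_add cong_mult cong_refl)
  also have "q * (P * ?t + ?s) + ?v = P * (q * ?t + ?v)"
  proof -
    \<comment> \<open>Here \<open>?s = g * ?v\<close> and \<open>g * q = P - 1\<close>, so the new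
      constant is again a multiple of \<open>P\<close>.\<close>
    have "q * ?s + ?v = (g * q) * ?v + ?v"
      using g_dvd_S by (simp add: ac_simps)
    also have "\<dots> = P * ?v"
      using P by (simp add: g_q algebra_simps)
    finally show ?thesis
      by (simp add: algebra_simps)
  qed
  finally have "gcd N2 (q * (?y div m) + ?v) = gcd N2 (P * (q * ?t + ?v))"
    by (metis cong_gcd_eq gcd.commute)
  also have "\<dots> = gcd N2 (q * ?t + ?v)"
    using coprime_P by (intro gcd_mult_right_left_cancel) (simp add: coprime_commute)
  finally show ?thesis
    by (simp add: level_def)
qed

lemma level_funpow:
  assumes x: "x \<in> {1..n}" "m dvd x" and k: "m dvd (\<pi> ^^ k) x"
  shows "level ((\<pi> ^^ k) x) = level x"
proof -
  have "level ((\<pi> ^^ (m * j)) x) = level x" for j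
  proof (induction j)
    case 0
    show ?case by simp
  next
    case (Suc j)
    have "(\<pi> ^^ (m * Suc j)) x = (\<pi> ^^ m) ((\<pi> ^^ (m * j)) x)"
      by (simp add: funpow_add)
    moreover have "m dvd (\<pi> ^^ (m * j)) x"
      using dvd_funpow_iff[OF x] by simp
    ultimately show ?case
      using Suc level_funpow_m[OF funpow_in[OF x(1)]] by simp
  qed
  then show ?thesis
    using k dvd_funpow_iff[OF x] by (auto elim!: dvdE)
qed

text \<open>The multiples of \<open>m\<close> up to \<open>n\<close> are the numbers
  \<open>m * (t + 1)\<close> with \<open>t < N1 * N2\<close>; starting at \<open>t = 0\<close> adds
  \<open>q\<close> to the constant of the affine form, and \<open>card_affine_gcd\<close> permits
  any constant.\<close>

lemma card_level:
  assumes "d dvd N2"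
  shows "card {x \<in> {1..n}. m dvd x \<and> level x = d} = N1 * totient d"
proof -
  let ?v = "S div m div g"
  let ?T = "{t \<in> {..<N1 * N2}. N2 div gcd N2 (q * t + (q + ?v)) = d}"
  have level: "level (m * Suc t) = N2 div gcd N2 (q * t + (q + ?v))" for t
    using m by (simp add: level_def algebra_simps)
  have "{x \<in> {1..n}. m dvd x \<and> level x = d} = (\<lambda>t. m * Suc t) ` ?T"
  proof (intro equalityI subsetI)
    fix x assume x: "x \<in> {x \<in> {1..n}. m dvd x \<and> level x = d}"
    then obtain u where u: "x = m * u" by (auto elim: dvdE)
    then obtain t where t: "u = Suc t"
      using x by (cases u) auto
    have "m * Suc t \<le> m * (N1 * N2)"
      using x unfolding u t n_eq by simp
    then have "t < N1 * N2"
      using m by (simp only: mult_le_cancel1 Suc_le_eq)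
    then have "t \<in> ?T"
      using x level[of t] unfolding u t by simp
    then show "x \<in> (\<lambda>t. m * Suc t) ` ?T"
      unfolding u t by (rule imageI)
  next
    fix x assume "x \<in> (\<lambda>t. m * Suc t) ` ?T"
    then obtain t where t: "t < N1 * N2" "N2 div gcd N2 (q * t + (q + ?v)) = d" "x = m * Suc t"
      by auto
    have "m * Suc t \<le> n"
      unfolding n_eq using t(1) by (intro mult_left_mono) auto
    moreover have "m * Suc t \<ge> 1"
      using m by simp
    ultimately show "x \<in> {x \<in> {1..n}. m dvd x \<and> level x = d}"
      using t level[of t] by (simp del: mult_Suc_right)
  qed
  moreover have "inj_on (\<lambda>t. m * Suc t) ?T"
    using m by (intro inj_onI) (simp del: mult_Suc_right)
  ultimately show ?thesis
    using card_affine_gcd[OF q_N2 N2 assms, of N1 "q + ?v"] by (simp only: card_image)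
qed

section \<open>Orbits, their levels and their number\<close>

lemma orbit_eq:
  assumes "y \<in> orbit \<pi> x"
  shows "orbit \<pi> y = orbit \<pi> x"
  using cyclic_on_orbit[OF permutes finite_atLeastAtMost] assms by (rule orbit_cyclic_eq3)

lemma self_in_orbit: "x \<in> orbit \<pi> x"
  using permutes by (intro permutation_self_in_orbit) (auto simp: permutation_permutes)

lemma orbit_representative:
  assumes "X \<in> orbit \<pi> ` {1..n}"
  obtains x where "x \<in> {1..n}" "m dvd x" "X = orbit \<pi> x"
proof -
  obtain y where y: "y \<in> {1..n}" "X = orbit \<pi> y"
    using assms by blast
  obtain k where k: "m dvd (\<pi> ^^ k) y"
    using y(1) by (rule reaches_multiple)
  have "orbit \<pi> ((\<pi> ^^ k) y) = orbit \<pi> y"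
    by (intro orbit_eq funpow_in_orbit self_in_orbit)
  then show thesis
    using that[OF funpow_in[OF y(1)] k] y(2) by simp
qed

lemma level_orbit:
  assumes "x \<in> {1..n}" "m dvd x" "y \<in> orbit \<pi> x" "m dvd y"
  shows "level y = level x"
  using assms level_funpow by (auto simp: orbit_altdef)

text \<open>Among the exponents enumerating the orbit, exactly the multiples of \<open>m\<close>
  lead to multiples of \<open>m\<close>.\<close>

lemma card_orbit_multiples:
  assumes x: "x \<in> {1..n}" "m dvd x"
  shows "card {y \<in> orbit \<pi> x. m dvd y} = ord (N1 * q * level x) P"
proof -
  let ?o = "ord (N1 * q * level x) P"
  have bij: "bij_betw (\<lambda>k. (\<pi> ^^ k) x) {..<m * ?o} (orbit \<pi> x)"
    using bij_betw_funpow_orbit(1)[OF self_in_orbit, of x] unfolding card_orbit[OF x] .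
  then have inj: "inj_on (\<lambda>k. (\<pi> ^^ k) x) {..<m * ?o}"
    and img: "orbit \<pi> x = (\<lambda>k. (\<pi> ^^ k) x) ` {..<m * ?o}"
    by (simp_all add: bij_betw_def)
  have multiples: "{y \<in> orbit \<pi> x. m dvd y} = (\<lambda>k. (\<pi> ^^ k) x) ` {k \<in> {..<m * ?o}. m dvd k}"
    unfolding img using dvd_funpow_iff[OF x] by auto
  have "card {y \<in> orbit \<pi> x. m dvd y} = card {k \<in> {..<m * ?o}. m dvd k}"
    unfolding multiples using inj by (intro card_image) (rule inj_on_subset, auto)
  also have "{k \<in> {..<m * ?o}. m dvd k} = (\<lambda>j. m * j) ` {..<?o}"
  proof (intro equalityI subsetI)
    fix k assume k: "k \<in> {k \<in> {..<m * ?o}. m dvd k}"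
    then have "m dvd k" by simp
    then obtain j where j: "k = m * j" by (rule dvdE)
    have "j < ?o"
      using k m unfolding j by simp
    then show "k \<in> (\<lambda>j. m * j) ` {..<?o}"
      unfolding j by (intro imageI) simp
  qed (use m in auto)
  also have "card \<dots> = ?o"
    using m by (subst card_image) (auto intro: inj_onI)
  finally show ?thesis .
qed

text \<open>The label has to be a function of the orbit as a set, hence the choice of a point; on
  the orbits concerned the level does not depend on it.\<close>

definition orbit_level :: "nat set \<Rightarrow> nat" where
  "orbit_level X = level (SOME x. x \<in> X \<and> x \<in> {1..n} \<and> m dvd x)"

lemma orbit_level:
  assumes x: "x \<in> {1..n}" "m dvd x"
  shows "orbit_level (orbit \<pi> x) = level x"
proof -
  let ?P = "\<lambda>y. y \<in> orbit \<pi> x \<and> y \<in> {1..n} \<and> m dvd y"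
  have "?P x"
    using x self_in_orbit by blast
  then have "?P (SOME y. ?P y)"
    by (rule someI)
  then show ?thesis
    unfolding orbit_level_def using level_orbit[OF x] by blast
qed

text \<open>Double counting: the orbits of level \<open>d\<close> partition the
  \<open>N1 * totient d\<close> multiples of \<open>m\<close> of that level into parts of equal
  size. The product form yields both the number of orbits and the divisibility.\<close>

lemma card_orbits_level:
  assumes d: "d dvd N2"
  shows "card {X \<in> orbit \<pi> ` {1..n}. orbit_level X = d} * ord (N1 * q * d) P = totient d * N1"
proof -
  let ?C = "{X \<in> orbit \<pi> ` {1..n}. orbit_level X = d}"
  let ?M = "\<lambda>X. {y \<in> X. m dvd y}"
  have rep: "\<exists>x. x \<in> {1..n} \<and> m dvd x \<and> X = orbit \<pi> x \<and> level x = d" if "X \<in> ?C" for X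
  proof -
    from that have X: "X \<in> orbit \<pi> ` {1..n}" "orbit_level X = d" by auto
    from X(1) obtain x where x: "x \<in> {1..n}" "m dvd x" "X = orbit \<pi> x"
      by (rule orbit_representative)
    then show ?thesis
      using X(2) orbit_level[OF x(1,2)] by (intro exI[of _ x]) simp
  qed
  have "{x \<in> {1..n}. m dvd x \<and> level x = d} = (\<Union>X\<in>?C. ?M X)"
  proof (intro equalityI subsetI)
    fix x assume x: "x \<in> {x \<in> {1..n}. m dvd x \<and> level x = d}"
    then have "orbit \<pi> x \<in> ?C"
      using orbit_level[of x] by simp
    then show "x \<in> (\<Union>X\<in>?C. ?M X)"
      using x self_in_orbit[of x] by (intro UN_I[of "orbit \<pi> x"]) simp_all
  next
    fix y assume "y \<in> (\<Union>X\<in>?C. ?M X)"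
    then obtain X where X: "X \<in> ?C" "y \<in> X" "m dvd y"
      by blast
    from rep[OF X(1)] obtain x where x: "x \<in> {1..n}" "m dvd x" "X = orbit \<pi> x" "level x = d"
      by blast
    have "y \<in> {1..n}"
      using permutes_orbit_subset[OF permutes x(1)] X(2) x(3) by blast
    then show "y \<in> {x \<in> {1..n}. m dvd x \<and> level x = d}"
      using level_orbit[OF x(1,2)] X x by simp
  qed
  moreover have "card (\<Union>X\<in>?C. ?M X) = (\<Sum>X\<in>?C. card (?M X))"
  proof (rule card_UN_disjoint)
    show "finite ?C" by simp
    show "\<forall>X\<in>?C. finite (?M X)"
      using finite_orbit[OF self_in_orbit] by auto
    show "\<forall>X\<in>?C. \<forall>Y\<in>?C. X \<noteq> Y \<longrightarrow> ?M X \<inter> ?M Y = {}"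
    proof (intro ballI impI equals0I)
      fix X Y y assume XY: "X \<in> ?C" "Y \<in> ?C" "X \<noteq> Y" and y: "y \<in> ?M X \<inter> ?M Y"
      then have "orbit \<pi> y = X" "orbit \<pi> y = Y"
        using orbit_eq[of y] by auto
      then show False using XY(3) by simp
    qed
  qed
  moreover have "card (?M X) = ord (N1 * q * d) P" if "X \<in> ?C" for X
    using rep[OF that] card_orbit_multiples by auto
  ultimately show ?thesis
    using card_level[OF d] by (simp add: mult.commute)
qed

lemma cycle_decomposition_iso:
  "digraph_iso (with_proj (cycle_decomposition \<pi> {1..n}))
    (with_proj (disjoint_union {d. d dvd N2} (\<lambda>d.
      copies (totient d * N1 div ord (N1 * q * d) P) (Cyc (m * ord (N1 * q * d) P)))))"
proof (rule cycle_decomposition_isoI[OF permutes finite_atLeastAtMost, where D = orbit_level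
      and k = "\<lambda>d. totient d * N1 div ord (N1 * q * d) P"
      and l = "\<lambda>d. m * ord (N1 * q * d) P"])
  fix X assume "X \<in> orbit \<pi> ` {1..n}"
  then obtain x where x: "x \<in> {1..n}" "m dvd x" "X = orbit \<pi> x"
    by (rule orbit_representative)
  show "orbit_level X \<in> {d. d dvd N2}"
    using x(3) orbit_level[OF x(1,2)] level_dvd by simp
  show "card X = m * ord (N1 * q * orbit_level X) P"
    using x(3) orbit_level[OF x(1,2)] card_orbit[OF x(1,2)] by simp
next
  fix d assume "d \<in> {d. d dvd N2}"
  then have d: "d dvd N2" by simp
  then have "ord (N1 * q * d) P > 0"
    using coprime_P_eta by simp
  then show "card {X \<in> orbit \<pi> ` {1..n}. orbit_level X = d} = totient d * N1 div ord (N1 * q * d) P"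
    unfolding card_orbits_level[OF d, symmetric] by simp
qed

end

theorem theorem3p8:
  fixes m n N1 N2 P S g :: nat
    and \<pi> a b c \<eta> :: "nat \<Rightarrow> nat"
  assumes "m > 1" and "n > 0" and "m dvd n"
    and "is_pap n m \<pi> a b c"
    and "P = principal_product m a" and "P > 1"
    and "S = principal_sum n m \<pi> a"
    and "g = gcd (S div m) (P - 1)"
    and "n div m = N1 * N2"
    and "rad N1 dvd (P - 1) div g"
    and "gcd ((P - 1) div g) N2 = 1"
    and "\<And>d. d dvd N2 \<Longrightarrow> \<eta> d = N1 * ((P - 1) div g) * d"
  shows "(\<forall>d. d dvd N2 \<longrightarrow> ord (\<eta> d) P dvd totient d * N1) \<and>
    digraph_iso
      (with_proj (cycle_decomposition \<pi> {1..n}))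
      (with_proj (disjoint_union {d. d dvd N2}
         (\<lambda>d. copies (totient d * N1 div ord (\<eta> d) P) (Cyc (m * ord (\<eta> d) P)))))"
proof -
  have "coprime ((P - 1) div g) N2"
    unfolding coprime_iff_gcd_eq_1 by (rule assms(11))
  then interpret principal_pap n m \<pi> a b c N1 N2 P S g "(P - 1) div g"
    using assms(1-10) by unfold_locales simp_all
  have "ord (\<eta> d) P dvd totient d * N1" if "d dvd N2" for d
    unfolding assms(12)[OF that] card_orbits_level[OF that, symmetric] by simp
  \<comment> \<open>The values of \<open>\<eta>\<close> are prescribed only at divisors of
    \<open>N2\<close>, so they are replaced under the index set.\<close>
  moreover have "disjoint_union {d. d dvd N2}
      (\<lambda>d. copies (totient d * N1 div ord (\<eta> d) P) (Cyc (m * ord (\<eta> d) P)))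
    = disjoint_union {d. d dvd N2} (\<lambda>d. copies
      (totient d * N1 div ord (N1 * ((P - 1) div g) * d) P)
      (Cyc (m * ord (N1 * ((P - 1) div g) * d) P)))"
    using assms(12) by (auto simp: disjoint_union_def)
  ultimately show ?thesis
    using cycle_decomposition_iso by simp
qed

end
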